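(* There are absolute constants $0<c_1\le c_2$ such that for any $n,m\in\mathbb{N}$ with $n\geq 8m^2$ there is a convex set $A\subset\mathbb{R}$ with $c_1 n\le |A|\le c_2 n$ which contains at least $\frac{n}{4m}$ pairwise disjoint arithmetic progressions, each of length $m$.
   Context: A convex set is a finite set $A=\{a_1<\cdots<a_n\}\subset\mathbb{R}$ whose consecutive differences $a_{i+1}-a_i$ form a strictly increasing sequence. *)

theory Defs
  imports Complex_Main
begin

(* Unrelated to convexity of subsets of a vector space: here a finite set of reals
   a 1 < ... < a n is convex if its consecutive gaps a (i + 1) - a i, for i = 1, ..., n - 1,
   strictly increase.  Sets with at most two elements qualify vacuously. *)
definition convex_set :: "real set \<Rightarrow> bool" where
  "convex_set A \<longleftrightarrow>
     (\<exists>n (a :: nat \<Rightarrow> real). A = a ` {1..n} \<and> strict_mono_on {1..n} a \<and>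
        strict_mono_on {1..<n} (\<lambda>i. a (i + 1) - a i))"

(* The length is the number of terms; the common difference is nonzero, without loss of
   generality positive, so the terms are distinct. *)
definition arith_prog :: "nat \<Rightarrow> real set \<Rightarrow> bool" where
  "arith_prog m P \<longleftrightarrow> (\<exists>a d. d > 0 \<and> P = (\<lambda>i. a + real i * d) ` {..<m})"

end

theory Submission
  imports Defs
begin

text \<open>
  A convex set is encoded by its list of gaps, and gap lists can be concatenated after rescaling
  the second one. So it suffices to find, for each \<open>m\<close>, one block of \<open>O(m\<^sup>2)\<close> increasing gaps
  containing \<open>m\<close> disjoint progressions of length \<open>m\<close>, and to chain about \<open>n / m\<^sup>2\<close> copies of it.
  In the block, the \<open>j\<close>-th progression has start \<open>j m + j\<^sup>2 / (4 m)\<close> and difference \<open>D + j\<close> with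
  \<open>D = 10 m\<^sup>2\<close>. Its \<open>i\<close>-th terms, for \<open>j < m\<close>, form a row with gaps slightly larger than \<open>m + i\<close>,
  so the gaps increase with \<open>i\<close>. The space left between two consecutive rows is so long,
  at least \<open>8 m\<^sup>2\<close>, that it can be cut into \<open>O(m)\<close> gaps, all of them between \<open>m + i + 1/2\<close> and \<open>m + i + 1\<close>.
\<close>

section \<open>Gap lists and their partial sums\<close>

definition gaps :: "real list \<Rightarrow> bool" where
  "gaps gs \<longleftrightarrow> sorted_wrt (<) gs \<and> (\<forall>g\<in>set gs. 0 < g)"

text \<open>The endpoint \<open>sum_list gs\<close> is left out, so that the points of a concatenation form a
  disjoint union.\<close>

definition pts :: "real list \<Rightarrow> real set" where
  "pts gs = (\<lambda>i. sum_list (take i gs)) ` {..<length gs}"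

definition packs :: "nat \<Rightarrow> nat \<Rightarrow> real set \<Rightarrow> bool" where
  "packs m k B \<longleftrightarrow> (\<exists>F. finite F \<and> card F = k \<and> (\<forall>P\<in>F. arith_prog m P \<and> P \<subseteq> B) \<and>
     (\<forall>P\<in>F. \<forall>Q\<in>F. P \<noteq> Q \<longrightarrow> P \<inter> Q = {}))"

lemma sum_list_take_Suc:
  fixes gs :: "'a::ab_group_add list"
  shows "i < length gs \<Longrightarrow> sum_list (take (Suc i) gs) = sum_list (take i gs) + gs ! i"
  by (simp add: take_Suc_conv_app_nth)

lemma sum_list_take_strict_mono:
  assumes "gaps gs" "i < j" "j \<le> length gs"
  shows "sum_list (take i gs) < sum_list (take j gs)"
  using assms(2,3)
proof (induction j)
  case (Suc j)
  have "0 < gs ! j" using assms(1) Suc.prems by (simp add: gaps_def)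
  then have "sum_list (take j gs) < sum_list (take (Suc j) gs)"
    using Suc.prems by (subst sum_list_take_Suc) auto
  then show ?case using Suc by (cases "i = j") auto
qed simp

lemma inj_on_sum_list_take:
  assumes "gaps gs"
  shows "inj_on (\<lambda>i. sum_list (take i gs)) {..length gs}"
  by (rule linorder_inj_onI') (use sum_list_take_strict_mono[OF assms] in fastforce)

lemma card_pts: "gaps gs \<Longrightarrow> card (pts gs) = length gs"
  unfolding pts_def
  by (subst card_image) (auto intro: inj_on_subset[OF inj_on_sum_list_take])

lemma finite_pts: "finite (pts gs)"
  by (simp add: pts_def)

lemma pts_bounds:
  assumes "gaps gs" "x \<in> pts gs"
  shows "0 \<le> x" "x < sum_list gs"
proof -
  obtain i where i: "i < length gs" "x = sum_list (take i gs)"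
    using assms(2) by (auto simp: pts_def)
  show "x < sum_list gs"
    using sum_list_take_strict_mono[OF assms(1) i(1) order_refl] i(2) by simp
  show "0 \<le> x"
    using sum_list_take_strict_mono[OF assms(1), of 0 i] i by (cases "i = 0") auto
qed

lemma convex_set_pts:
  assumes "gaps gs"
  shows "convex_set (pts gs)"
proof -
  \<comment> \<open>The shift by one matches the indexing from 1 in \<open>convex_set\<close>. The
    last gap of \<open>gs\<close> is never a difference of two points, since \<open>pts\<close>
    omits the endpoint.\<close>
  define a where "a i = sum_list (take (i - 1) gs)" for i
  have diff: "a (i + 1) - a i = gs ! (i - 1)" if "i \<in> {1..<length gs}" for i
    using that sum_list_take_Suc[of "i - 1" gs] by (auto simp: a_def)
  have "pts gs = a ` {1..length gs}"
  proof -
    have "{1..length gs} = Suc ` {..<length gs}"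
      by (simp add: lessThan_atLeast0 image_Suc_atLeastLessThan atLeastLessThanSuc_atLeastAtMost)
    then show ?thesis by (simp add: pts_def a_def image_image)
  qed
  moreover have "strict_mono_on {1..length gs} a"
    by (rule strict_mono_onI) (use sum_list_take_strict_mono[OF assms] in \<open>auto simp: a_def\<close>)
  moreover have "strict_mono_on {1..<length gs} (\<lambda>i. a (i + 1) - a i)"
  proof (rule strict_mono_onI)
    fix i j assume ij: "i \<in> {1..<length gs}" "j \<in> {1..<length gs}" "i < j"
    then have "gs ! (i - 1) < gs ! (j - 1)"
      using assms by (intro sorted_wrt_nth_less[of "(<)"]) (auto simp: gaps_def)
    then show "a (i + 1) - a i < a (j + 1) - a j"
      using diff ij by simp
  qed
  ultimately show ?thesis unfolding convex_set_def by blast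
qed

lemma pts_append: "pts (gs @ hs) = pts gs \<union> (+) (sum_list gs) ` pts hs"
proof -
  have "(+) (length gs) ` {..<length hs} = {length gs..<length gs + length hs}"
    by (simp add: lessThan_atLeast0 add.commute)
  then have "{..<length (gs @ hs)} = {..<length gs} \<union> (+) (length gs) ` {..<length hs}"
    by auto
  then show ?thesis by (simp only: pts_def image_Un image_image) simp
qed

lemma pts_scale: "pts (map ((*) c) gs) = (*) c ` pts gs"
proof -
  have "sum_list (map ((*) c) xs) = c * sum_list xs" for xs
    by (simp add: sum_list_const_mult)
  then show ?thesis by (simp add: pts_def take_map image_image)
qed

lemma pts_concat:
  assumes "\<And>i. i < k \<Longrightarrow> sum_list (row i) = D"
  shows "pts (concat (map row [0..<k])) = (\<Union>i<k. (+) (real i * D) ` pts (row i))"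
    and "sum_list (concat (map row [0..<k])) = real k * D"
proof -
  \<comment> \<open>Both claims go into one induction: an appended row is shifted by the sum of the
    rows before it.\<close>
  have "pts (concat (map row [0..<k])) = (\<Union>i<k. (+) (real i * D) ` pts (row i)) \<and>
    sum_list (concat (map row [0..<k])) = real k * D"
    using assms
  proof (induction k)
    case (Suc k)
    then show ?case by (simp add: pts_append lessThan_Suc Un_commute distrib_right)
  qed (simp add: pts_def)
  then show "pts (concat (map row [0..<k])) = (\<Union>i<k. (+) (real i * D) ` pts (row i))"
    and "sum_list (concat (map row [0..<k])) = real k * D" by auto
qed

section \<open>Disjoint families of progressions\<close>

lemma arith_prog_affine:
  assumes "arith_prog m P" "0 < c"
  shows "arith_prog m ((\<lambda>x. t + c * x) ` P)"
proof -
  obtain a d where ad: "d > 0" "P = (\<lambda>i. a + real i * d) ` {..<m}"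
    using assms(1) by (auto simp: arith_prog_def)
  have "(\<lambda>x. t + c * x) ` P = (\<lambda>i. (t + c * a) + real i * (c * d)) ` {..<m}"
    by (simp add: ad image_image algebra_simps)
  then show ?thesis using assms(2) ad(1) unfolding arith_prog_def
    by (metis mult_pos_pos)
qed

lemma card_arith_prog: "arith_prog m P \<Longrightarrow> card P = m"
  by (auto simp: arith_prog_def card_image inj_on_def)

lemma packs_affine:
  assumes "packs m k B" "0 < c"
  shows "packs m k ((\<lambda>x. t + c * x) ` B)"
proof -
  let ?f = "\<lambda>x::real. t + c * x"
  obtain F where F: "finite F" "card F = k" "\<And>P. P \<in> F \<Longrightarrow> arith_prog m P"
    "\<And>P. P \<in> F \<Longrightarrow> P \<subseteq> B" "\<And>P Q. P \<in> F \<Longrightarrow> Q \<in> F \<Longrightarrow> P \<noteq> Q \<Longrightarrow> P \<inter> Q = {}"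
    using assms(1) by (auto simp: packs_def)
  have inj: "inj ?f" using assms(2) by (simp add: inj_def)
  have "inj_on ((`) ?f) F"
    by (rule inj_onI) (simp only: inj_image_eq_iff[OF inj])
  then have "card ((`) ?f ` F) = k"
    using F(2) by (simp add: card_image)
  moreover have "?f ` P \<inter> ?f ` Q = {}" if "P \<in> F" "Q \<in> F" "?f ` P \<noteq> ?f ` Q" for P Q
  proof -
    have "P \<inter> Q = {}" using F(5) that by blast
    then show ?thesis by (metis image_Int[OF inj] image_empty)
  qed
  moreover have "arith_prog m (?f ` P)" "?f ` P \<subseteq> ?f ` B" if "P \<in> F" for P
    using F(3,4)[OF that] assms(2) by (simp_all add: arith_prog_affine image_mono)
  ultimately show ?thesis
    unfolding packs_def using F(1)
    by (intro exI[of _ "(`) ?f ` F"]) (simp add: ball_simps)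
qed

lemma packs_Un:
  assumes "packs m k B" "packs m l C" "B \<inter> C = {}" "1 \<le> m"
  shows "packs m (k + l) (B \<union> C)"
proof -
  obtain F where F: "finite F" "card F = k" "\<forall>P\<in>F. arith_prog m P \<and> P \<subseteq> B"
    "\<forall>P\<in>F. \<forall>Q\<in>F. P \<noteq> Q \<longrightarrow> P \<inter> Q = {}"
    using assms(1) by (auto simp: packs_def)
  obtain G where G: "finite G" "card G = l" "\<forall>P\<in>G. arith_prog m P \<and> P \<subseteq> C"
    "\<forall>P\<in>G. \<forall>Q\<in>G. P \<noteq> Q \<longrightarrow> P \<inter> Q = {}"
    using assms(2) by (auto simp: packs_def)
  have disj: "P \<inter> Q = {}" if "P \<in> F" "Q \<in> G" for P Q
    using F(3) G(3) assms(3) that by blast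
  \<comment> \<open>For \<open>m = 0\<close> the empty set could lie in both families and be counted
    twice; nonempty progressions in disjoint sets cannot coincide.\<close>
  have "P \<noteq> {}" if "P \<in> F" for P
    using F(3) that card_arith_prog[of m P] assms(4) by fastforce
  then have "F \<inter> G = {}" using disj by (metis disjoint_iff inf.idem)
  then have "card (F \<union> G) = k + l" using F G by (simp add: card_Un_disjoint)
  moreover have "\<forall>P\<in>F \<union> G. \<forall>Q\<in>F \<union> G. P \<noteq> Q \<longrightarrow> P \<inter> Q = {}"
    using F(4) G(4) disj by (metis Int_commute UnE)
  moreover have "\<forall>P\<in>F \<union> G. arith_prog m P \<and> P \<subseteq> B \<union> C"
    using F(3) G(3) by blast
  ultimately show ?thesis unfolding packs_def using F(1) G(1)
    by (intro exI[of _ "F \<union> G"]) simp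
qed

text \<open>Gives the lower bound on the size of the final convex set with no separate count of its
  points.\<close>

lemma packs_card_le:
  assumes "packs m k B" "finite B"
  shows "k * m \<le> card B"
proof -
  obtain F where F: "finite F" "card F = k" "\<And>P. P \<in> F \<Longrightarrow> arith_prog m P \<and> P \<subseteq> B"
    "\<forall>P\<in>F. \<forall>Q\<in>F. P \<noteq> Q \<longrightarrow> P \<inter> Q = {}"
    using assms(1) by (auto simp: packs_def)
  have "card (\<Union>F) = (\<Sum>P\<in>F. card P)"
    using F assms(2) by (intro card_Union_disjoint)
      (auto simp: pairwise_def disjnt_def intro: finite_subset)
  also have "\<dots> = (\<Sum>P\<in>F. m)" using F(3) card_arith_prog by (intro sum.cong) auto
  also have "\<dots> = k * m" by (simp add: F(2))
  finally show ?thesis using F(3) assms(2) by (metis Sup_least card_mono)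
qed

section \<open>Concatenation after rescaling\<close>

text \<open>For fixed \<open>s\<close> and \<open>t\<close> every \<open>c > s / t\<close> works,
  and finitely many such conditions hold together for all large \<open>c\<close>.\<close>

lemma exists_dominating_scale:
  fixes S T :: "real set"
  assumes "finite S" "finite T" "\<And>t. t \<in> T \<Longrightarrow> 0 < t"
  shows "\<exists>c>0. \<forall>s\<in>S. \<forall>t\<in>T. s < c * t"
proof -
  have "\<forall>\<^sub>F c in at_top. s < c * t" if "t \<in> T" for s t
    using eventually_gt_at_top[of "s / t"] assms(3)[OF that]
    by (auto elim!: eventually_mono simp: divide_less_eq)
  then have "\<forall>\<^sub>F c in at_top. 0 < c \<and> (\<forall>s\<in>S. \<forall>t\<in>T. s < c * t)"
    using assms(1,2) by (intro eventually_conj eventually_gt_at_top) (auto simp: eventually_ball_finite_distrib)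
  then show ?thesis using eventually_happens by fastforce
qed

text \<open>A large \<open>c\<close> makes all gaps of the second list exceed those of the first,
  and affine maps preserve progressions. The second piece starts at \<open>sum_list gs\<close>,
  which no point of \<open>pts gs\<close> reaches, so the two families stay disjoint.\<close>

lemma packs_append_scaled:
  assumes "1 \<le> m" "gaps gs" "packs m k (pts gs)" "gaps hs" "packs m l (pts hs)"
  obtains c where "gaps (gs @ map ((*) c) hs)" "packs m (k + l) (pts (gs @ map ((*) c) hs))"
proof -
  obtain c where c: "0 < c" "\<And>s t. s \<in> set gs \<Longrightarrow> t \<in> set hs \<Longrightarrow> s < c * t"
    using exists_dominating_scale[of "set gs" "set hs"] assms(4) by (auto simp: gaps_def)
  have g: "gaps (gs @ map ((*) c) hs)"
    using assms(2,4) c by (auto simp: gaps_def sorted_wrt_append sorted_wrt_map)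
  have eq: "pts (gs @ map ((*) c) hs) = pts gs \<union> (\<lambda>x. sum_list gs + c * x) ` pts hs"
    by (simp add: pts_append pts_scale image_image)
  have "pts gs \<inter> (\<lambda>x. sum_list gs + c * x) ` pts hs = {}"
  proof -
    have "sum_list gs \<le> sum_list gs + c * x" if "x \<in> pts hs" for x
      using pts_bounds(1)[OF assms(4) that] c(1) by simp
    then show ?thesis using pts_bounds(2)[OF assms(2)] by fastforce
  qed
  then have "packs m (k + l) (pts (gs @ map ((*) c) hs))"
    unfolding eq using assms c(1) by (intro packs_Un packs_affine) auto
  with g show ?thesis by (rule that)
qed

section \<open>One row of the block\<close>

text \<open>The hypotheses put the mean \<open>G / r\<close> strictly between \<open>lo\<close> and
  \<open>hi\<close>; an arithmetic progression centred there with a small enough step does the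
  job.\<close>

lemma strict_sorted_list_with_sum:
  fixes lo hi G :: real
  assumes "1 \<le> r" "real r * lo < G" "G < real r * hi"
  shows "\<exists>xs. length xs = r \<and> sorted_wrt (<) xs \<and> (\<forall>x\<in>set xs. lo < x \<and> x < hi) \<and> sum_list xs = G"
proof -
  define a where "a = G / real r"
  define t where "t = min (a - lo) (hi - a) / real r"
  have r: "real r > 0" using assms(1) by simp
  have a: "lo < a" "a < hi" "real r * a = G"
    using assms r by (auto simp: a_def field_simps)
  have t: "0 < t" "real r * t \<le> a - lo" "real r * t \<le> hi - a"
    using a r by (auto simp: t_def)
  \<comment> \<open>The offsets \<open>2 * k + 1 - r\<close> are symmetric about 0, so they cancel
    in the sum over \<open>k < r\<close>. They lie strictly between \<open>- r\<close> and
    \<open>r\<close>, which is why \<open>t\<close> was chosen with \<open>r * t\<close> at most the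
    distance from \<open>a\<close> to either bound.\<close>
  define x where "x k = a + t * (2 * real k + 1 - real r)" for k :: nat
  have sum: "(\<Sum>k<q. x k) = real q * a + t * (real q * real q - real q * real r)" for q
    by (induction q) (auto simp: x_def algebra_simps)
  have "lo < x k \<and> x k < hi" if "k < r" for k
  proof -
    have "(2 * real k + 1 - real r) * t < real r * t" "- real r * t < (2 * real k + 1 - real r) * t"
      using that t(1) by (intro mult_strict_right_mono; simp)+
    then have "lo < a + (2 * real k + 1 - real r) * t" "a + (2 * real k + 1 - real r) * t < hi"
      using t by linarith+
    then show ?thesis by (simp only: x_def mult.commute[of t] simp_thms)
  qed
  moreover have "sorted_wrt (<) (map x [0..<r])"
    using t(1) by (simp add: sorted_wrt_map x_def)
  moreover have "sum_list (map x [0..<r]) = G"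
    using sum[of r] a(3) by (simp add: interv_sum_list_conv_sum_set_nat lessThan_atLeast0)
  ultimately show ?thesis by (intro exI[of _ "map x [0..<r]"]) auto
qed

lemma sorted_wrt_concat_map_upt:
  assumes "\<And>i. i < k \<Longrightarrow> sorted_wrt R (row i)"
    and "\<And>i j x y. i < j \<Longrightarrow> j < k \<Longrightarrow> x \<in> set (row i) \<Longrightarrow> y \<in> set (row j) \<Longrightarrow> R x y"
  shows "sorted_wrt R (concat (map row [0..<k]))"
  using assms
proof (induction k)
  case (Suc k)
  then show ?case by (auto simp: sorted_wrt_append)
qed simp

lemma row_exists:
  fixes m i :: nat
  assumes "i < m"
  obtains gs where "sorted_wrt (<) gs"
    and "\<And>g. g \<in> set gs \<Longrightarrow> real (m + i) < g \<and> g < real (m + i) + 1"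
    and "sum_list gs = 10 * real m ^ 2" and "length gs \<le> 11 * m"
    and "\<And>j. j < m \<Longrightarrow> real j * real (m + i) + real j ^ 2 / (4 * real m) \<in> pts gs"
proof -
  \<comment> \<open>The gaps between the prescribed points. Their odd numerators sum to squares,
    which produces the term \<open>j ^ 2 / (4 * m)\<close>; without this perturbation all these gaps
    would equal \<open>m + i\<close>.\<close>
  define e where "e l = real (m + i) + (2 * real l + 1) / (4 * real m)" for l :: nat
  have m: "0 < real m" "real i + 1 \<le> real m" using assms by auto
  have e_sum: "(\<Sum>l<j. e l) = real j * real (m + i) + real j ^ 2 / (4 * real m)" for j
    using m by (induction j) (auto simp: e_def field_simps power2_eq_square)
  have e_bd: "real (m + i) < e l" "e l < real (m + i) + 1 / 2" if "l < m - 1" for l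
  proof -
    show "real (m + i) < e l" using m by (simp add: e_def)
    have "2 * real l + 1 < 2 * real m" using that by linarith
    then show "e l < real (m + i) + 1 / 2" using m by (simp add: e_def field_simps)
  qed
  \<comment> \<open>The space from the last prescribed point to the start of the next row. The
    prescribed gaps take at most \<open>2 * m ^ 2\<close> of the row length
    \<open>10 * m ^ 2\<close>.\<close>
  define G where "G = 10 * real m ^ 2 - (\<Sum>l<m - 1. e l)"
  have "0 \<le> (\<Sum>l<m - 1. e l)" using m by (intro sum_nonneg) (simp add: e_def)
  moreover have "(\<Sum>l<m - 1. e l) \<le> real (card {..<m - 1}) * (2 * real m)"
  proof (rule sum_bounded_above)
    fix l assume "l \<in> {..<m - 1}"
    then show "e l \<le> 2 * real m" using e_bd(2)[of l] m by simp
  qed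
  moreover have "real (card {..<m - 1}) * (2 * real m) \<le> real m * (2 * real m)"
    by (intro mult_right_mono) auto
  ultimately have G: "8 * real m ^ 2 \<le> G" "G \<le> 10 * real m ^ 2"
    by (auto simp: G_def power2_eq_square)
  \<comment> \<open>Filler gaps come from the upper half of the interval, so they all follow the
    prescribed gaps, which lie in the lower half.\<close>
  define lo hi where "lo = real (m + i) + 1 / 2" and "hi = real (m + i) + 1"
  have bd: "real m < lo" "lo < 2 * real m" "hi \<le> 2 * real m" "hi = lo + 1 / 2" "0 < lo" "0 < hi"
    using m by (auto simp: lo_def hi_def)
  define r where "r = nat (\<lfloor>G / hi\<rfloor> + 1)"
  have G0: "0 < G" using G(1) m by (smt (verit) zero_less_power)
  then have q: "0 \<le> G / hi" using bd by simp
  have r1: "1 \<le> r" "G / hi < real r" "real r \<le> G / hi + 1"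
    using q by (simp_all add: r_def) linarith+
  \<comment> \<open>The number \<open>r\<close> of fillers must lie strictly between
    \<open>G / hi\<close> and \<open>G / lo\<close>. As \<open>hi - lo = 1 / 2\<close>, these differ
    by \<open>(G / 2) / (lo * hi)\<close>, which exceeds 1 because
    \<open>lo * hi < 4 * m ^ 2\<close> and \<open>G\<close> is at least
    \<open>8 * m ^ 2\<close>.\<close>
  have "lo * hi < (2 * real m) * (2 * real m)"
    using bd m by (intro mult_less_le_imp_less) auto
  then have "lo * hi < G / 2" using G(1) by (simp add: power2_eq_square)
  then have "1 < (G / 2) / (lo * hi)" using bd by (simp add: less_divide_eq)
  also have "(G / 2) / (lo * hi) = G / lo - G / hi"
    using bd(5,6) by (simp add: bd(4) field_simps)
  finally have "G / hi + 1 < G / lo" by simp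
  then have r2: "real r < G / lo" using r1(3) by linarith
  have r3: "real r * lo < G" "G < real r * hi" using r1(2) r2 bd(5,6)
    by (simp_all only: pos_divide_less_eq pos_less_divide_eq)
  have "real r * real m \<le> real r * lo" using bd by (intro mult_left_mono) auto
  then have "real r * real m < 10 * real m * real m" using r3(1) G(2) by (simp add: power2_eq_square)
  then have r_le: "r \<le> 10 * m" using m(1) by simp
  obtain xs where xs: "length xs = r" "sorted_wrt (<) xs"
      "\<And>x. x \<in> set xs \<Longrightarrow> lo < x \<and> x < hi" "sum_list xs = G"
    using strict_sorted_list_with_sum[OF r1(1) r3] by blast
  define gs where "gs = map e [0..<m - 1] @ xs"
  have "strict_mono e"
    using m(1) by (intro strict_monoI) (simp add: e_def divide_strict_right_mono)
  then have "sorted_wrt (<) (map e [0..<m - 1])"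
    by (simp add: sorted_wrt_map strict_mono_less)
  moreover have "e l < x" if "l < m - 1" "x \<in> set xs" for l x
    using e_bd(2)[OF that(1)] xs(3)[OF that(2)] by (simp add: lo_def)
  ultimately have "sorted_wrt (<) gs" using xs(2) by (auto simp: gs_def sorted_wrt_append)
  moreover have "real (m + i) < g \<and> g < real (m + i) + 1" if "g \<in> set gs" for g
    using that e_bd xs(3) by (fastforce simp: gs_def lo_def hi_def)
  moreover have "sum_list gs = 10 * real m ^ 2"
    by (simp add: gs_def xs(4) G_def interv_sum_list_conv_sum_set_nat lessThan_atLeast0)
  moreover have "length gs \<le> 11 * m" using r_le xs(1) by (simp add: gs_def)
  moreover have "real j * real (m + i) + real j ^ 2 / (4 * real m) \<in> pts gs" if "j < m" for j
  proof -
    have "take j gs = map e [0..<j]" using that by (simp add: gs_def take_map min_def)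
    then have "sum_list (take j gs) = real j * real (m + i) + real j ^ 2 / (4 * real m)"
      using e_sum[of j] by (simp add: interv_sum_list_conv_sum_set_nat lessThan_atLeast0)
    \<comment> \<open>For \<open>j = m - 1\<close> this needs at least one filler gap, since
      otherwise the point would be the omitted endpoint.\<close>
    moreover have "j < length gs" using that xs(1) r1(1) by (simp add: gs_def)
    ultimately show ?thesis unfolding pts_def by (metis image_eqI lessThan_iff)
  qed
  ultimately show ?thesis by (rule that)
qed

section \<open>Assembling the rows into a block\<close>

lemma block_exists:
  fixes m :: nat
  assumes "1 \<le> m"
  obtains gs where "gaps gs" "packs m m (pts gs)" "length gs \<le> 11 * m ^ 2"
proof -
  define D where "D = 10 * real m ^ 2"
  have m: "1 \<le> real m" using assms by simp
  define good where "good i gs \<longleftrightarrow> sorted_wrt (<) gs \<and>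
      (\<forall>g\<in>set gs. real (m + i) < g \<and> g < real (m + i) + 1) \<and> sum_list gs = D \<and> length gs \<le> 11 * m \<and>
      (\<forall>j<m. real j * real (m + i) + real j ^ 2 / (4 * real m) \<in> pts gs)" for i gs
  have "\<exists>gs. good i gs" if "i < m" for i
    by (rule row_exists[OF that]) (auto simp: good_def D_def)
  then obtain row where "\<And>i. i < m \<Longrightarrow> good i (row i)"
    by metis
  then have row: "\<And>i. i < m \<Longrightarrow> sorted_wrt (<) (row i)"
      "\<And>i g. i < m \<Longrightarrow> g \<in> set (row i) \<Longrightarrow> real (m + i) < g \<and> g < real (m + i) + 1"
      "\<And>i. i < m \<Longrightarrow> sum_list (row i) = D" "\<And>i. i < m \<Longrightarrow> length (row i) \<le> 11 * m"
      "\<And>i j. i < m \<Longrightarrow> j < m \<Longrightarrow> real j * real (m + i) + real j ^ 2 / (4 * real m) \<in> pts (row i)"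
    by (simp_all add: good_def)
  define gs where "gs = concat (map row [0..<m])"
  \<comment> \<open>The gaps of row \<open>i\<close> lie in the open interval from
    \<open>m + i\<close> to \<open>m + i + 1\<close>, and these intervals follow one
    another.\<close>
  have "sorted_wrt (<) gs" unfolding gs_def
  proof (rule sorted_wrt_concat_map_upt)
    fix i j x y assume "i < j" "j < m" "x \<in> set (row i)" "y \<in> set (row j)"
    then show "x < y" using row(2)[of i x] row(2)[of j y] by simp
  qed (use row(1) in auto)
  moreover have "0 < g" if g: "g \<in> set gs" for g
  proof -
    obtain i where "i < m" "g \<in> set (row i)" using g by (auto simp: gs_def)
    then show ?thesis using row(2)[of i g] by linarith
  qed
  ultimately have gaps: "gaps gs" by (simp add: gaps_def)
  have "length gs = (\<Sum>i<m. length (row i))"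
    by (simp add: gs_def length_concat comp_def interv_sum_list_conv_sum_set_nat lessThan_atLeast0)
  also have "\<dots> \<le> of_nat (card {..<m}) * (11 * m)"
    by (rule sum_bounded_above) (use row(4) in auto)
  finally have len: "length gs \<le> 11 * m ^ 2" by (simp add: power2_eq_square)
  define h where "h i j = real j * real (m + i) + real j ^ 2 / (4 * real m)" for i j :: nat
  have h_less: "h i j < h i j'" if "j < j'" for i j j'
  proof -
    have "real j * real (m + i) \<le> real j' * real (m + i)" using that by (intro mult_right_mono) auto
    moreover have "real j ^ 2 < real j' ^ 2" using that by (intro power_strict_mono) auto
    ultimately show ?thesis using m unfolding h_def
      by (intro add_le_less_mono divide_strict_right_mono) auto
  qed
  have h_bd: "0 \<le> h i j" "h i j < D" if "i < m" "j < m" for i j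
  proof -
    have ri: "\<forall>g\<in>set (row i). 0 < g"
      using row(2)[OF that(1)] by (metis le_less_trans of_nat_0_le_iff)
    have "h i j \<in> pts (row i)" using row(5)[OF that] by (simp add: h_def)
    then show "0 \<le> h i j" "h i j < D"
      using pts_bounds[of "row i" "h i j"] ri row(1,3)[OF that(1)] by (auto simp: gaps_def)
  qed
  define P where "P j = (\<lambda>i. (real j * real m + real j ^ 2 / (4 * real m)) + real i * (D + real j)) ` {..<m}" for j
  \<comment> \<open>The cross term \<open>i * j\<close> allows two readings: inside row
    \<open>i\<close> it enlarges the gaps by \<open>i\<close>, and along column \<open>j\<close> it
    enlarges the difference \<open>D\<close> by \<open>j\<close>.\<close>
  have P_alt: "P j = (\<lambda>i. real i * D + h i j) ` {..<m}" for j
    unfolding P_def h_def by (intro image_cong) (auto simp: algebra_simps)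
  have D0: "0 < D" using m by (simp add: D_def)
  \<comment> \<open>All offsets \<open>h i j\<close> lie in [0, D), so a common point determines its
    row; within a row the offsets are strictly increasing in \<open>j\<close>.\<close>
  have disj: "P j \<inter> P j' = {}" if "j < j'" "j' < m" for j j'
  proof (rule ccontr)
    assume "P j \<inter> P j' \<noteq> {}"
    then obtain i i' where i: "i < m" "i' < m" "real i * D + h i j = real i' * D + h i' j'"
      unfolding P_alt by auto
    have b: "0 \<le> h i j" "h i j < D" "0 \<le> h i' j'" "h i' j' < D"
      using h_bd i that by (meson less_trans)+
    have step: "real p * D + D \<le> real q * D" if "p < q" for p q :: nat
    proof -
      have "(real p + 1) * D \<le> real q * D" using that D0 by (intro mult_right_mono) auto
      then show ?thesis by (simp add: algebra_simps)
    qed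
    have "\<not> i < i'" "\<not> i' < i"
      using step[of i i'] step[of i' i] i(3) b by linarith+
    then have "h i j = h i j'" using i(3) by simp
    then show False using h_less[OF that(1), of i] by simp
  qed
  have disj': "P j \<inter> P j' = {}" if "j \<noteq> j'" "j < m" "j' < m" for j j'
    using disj[of j j'] disj[of j' j] that by (cases j j' rule: linorder_cases) auto
  have "P j \<noteq> {}" for j using assms by (auto simp: P_def lessThan_empty_iff)
  then have "inj_on P {..<m}" using disj' by (metis inj_onI inf.idem lessThan_iff)
  then have "card (P ` {..<m}) = m" by (simp add: card_image)
  moreover have "arith_prog m (P j)" for j
    unfolding arith_prog_def P_def using D0
    by (intro exI[of _ "real j * real m + real j ^ 2 / (4 * real m)"] exI[of _ "D + real j"]) simp
  moreover have "P j \<subseteq> pts gs" if "j < m" for j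
  proof -
    have "real i * D + h i j \<in> pts gs" if "i < m" for i
    proof -
      have "h i j \<in> pts (row i)" using row(5)[OF that \<open>j < m\<close>] by (simp add: h_def)
      then have "real i * D + h i j \<in> (+) (real i * D) ` pts (row i)" by (rule imageI)
      moreover have "pts gs = (\<Union>i<m. (+) (real i * D) ` pts (row i))"
        unfolding gs_def using row(3) by (rule pts_concat(1))
      ultimately show ?thesis using that by blast
    qed
    then show ?thesis unfolding P_alt by (intro image_subsetI) simp
  qed
  moreover have "\<forall>X\<in>P ` {..<m}. \<forall>Y\<in>P ` {..<m}. X \<noteq> Y \<longrightarrow> X \<inter> Y = {}"
  proof (intro ballI impI)
    fix X Y assume "X \<in> P ` {..<m}" "Y \<in> P ` {..<m}" "X \<noteq> Y"
    then obtain j j' where "X = P j" "Y = P j'" "j < m" "j' < m" "j \<noteq> j'"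
      by (metis imageE lessThan_iff)
    then show "X \<inter> Y = {}" using disj' by simp
  qed
  ultimately have "packs m m (pts gs)" unfolding packs_def
    by (intro exI[of _ "P ` {..<m}"]) simp
  with gaps len show ?thesis using that by blast
qed

section \<open>Chaining the blocks, and the theorem\<close>

lemma chain_exists:
  fixes m k :: nat
  assumes "1 \<le> m"
  shows "\<exists>gs. gaps gs \<and> packs m (k * m) (pts gs) \<and> length gs \<le> k * (11 * m ^ 2)"
proof (induction k)
  case 0
  show ?case by (intro exI[of _ "[]"]) (auto simp: gaps_def packs_def)
next
  case (Suc k)
  then obtain gs where gs: "gaps gs" "packs m (k * m) (pts gs)" "length gs \<le> k * (11 * m ^ 2)"
    by blast
  obtain hs where hs: "gaps hs" "packs m m (pts hs)" "length hs \<le> 11 * m ^ 2"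
    using block_exists[OF assms] .
  obtain c where "gaps (gs @ map ((*) c) hs)" "packs m (k * m + m) (pts (gs @ map ((*) c) hs))"
    using packs_append_scaled[OF assms gs(1,2) hs(1,2)] .
  then show ?case using gs(3) hs(3)
    by (intro exI[of _ "gs @ map ((*) c) hs"]) (auto simp: add.commute)
qed

theorem theorem2p1:
  "\<exists>c1 c2 :: real. 0 < c1 \<and> c1 \<le> c2 \<and>
     (\<forall>n m :: nat. 1 \<le> m \<longrightarrow> 8 * m ^ 2 \<le> n \<longrightarrow>
        (\<exists>A :: real set. convex_set A \<and>
           c1 * real n \<le> real (card A) \<and> real (card A) \<le> c2 * real n \<and>
           (\<exists>F :: real set set. finite F \<and> real n / (4 * real m) \<le> real (card F) \<and>
              (\<forall>P\<in>F. arith_prog m P \<and> P \<subseteq> A) \<and>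
              (\<forall>P\<in>F. \<forall>Q\<in>F. P \<noteq> Q \<longrightarrow> P \<inter> Q = {}))))"
proof -
  have "\<exists>A. convex_set A \<and> 1 / 4 * real n \<le> real (card A) \<and> real (card A) \<le> 11 * real n \<and>
      (\<exists>F. finite F \<and> real n / (4 * real m) \<le> real (card F) \<and>
        (\<forall>P\<in>F. arith_prog m P \<and> P \<subseteq> A) \<and> (\<forall>P\<in>F. \<forall>Q\<in>F. P \<noteq> Q \<longrightarrow> P \<inter> Q = {}))"
    if m: "1 \<le> m" and n: "8 * m ^ 2 \<le> n" for n m :: nat
  proof -
    define k where "k = n div m ^ 2"
    have le: "k * m ^ 2 \<le> n" by (simp add: k_def)
    \<comment> \<open>Since \<open>m ^ 2\<close> is at most \<open>n / 8\<close>, rounding down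
      loses little: \<open>k * m ^ 2 > 7 * n / 8\<close>, more than the factor 4 below
      requires.\<close>
    have "n < k * m ^ 2 + m ^ 2"
      using m dividend_less_div_times[of "m ^ 2" n] by (simp add: k_def add.commute)
    then have ge: "n \<le> 4 * (k * m * m)" using n by (simp add: power2_eq_square)
    obtain gs where gs: "gaps gs" "packs m (k * m) (pts gs)" "length gs \<le> k * (11 * m ^ 2)"
      using chain_exists[OF m] by blast
    \<comment> \<open>The \<open>k * m\<close> disjoint progressions alone supply at least
      \<open>n / 4\<close> points, hence the constant 1/4; the constant 11 comes from the block
      length.\<close>
    have "k * m * m \<le> card (pts gs)" using packs_card_le[OF gs(2) finite_pts] .
    then have "n \<le> 4 * card (pts gs)" using ge by linarith
    moreover have "card (pts gs) \<le> 11 * n" using card_pts[OF gs(1)] gs(3) le by simp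
    moreover have "real n / (4 * real m) \<le> real (k * m)"
    proof -
      have "real n \<le> real (4 * (k * m * m))" using ge of_nat_le_iff by blast
      then show ?thesis using m by (simp add: divide_le_eq algebra_simps)
    qed
    ultimately show ?thesis using convex_set_pts[OF gs(1)] gs(2) unfolding packs_def
      by (intro exI[of _ "pts gs"]) auto
  qed
  then show ?thesis by (intro exI[of _ "1 / 4"] exI[of _ 11]) auto
qed

end
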